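(* The ordinary generating function of the polynomials $\beta_n(x)$ is $$\sum_{n\geq 0}\beta_{n}(x)z^{n}=\frac{1}{1-2xz+(1+x^{2})z^{2}}.$$
   Context: For each integer $n\ge 0$, $\beta_n$ is the polynomial with real coefficients determined by $\beta_n(x)=\operatorname{Im}((x+i)^{n+1})$ for real $x$, i.e. $\beta_n(x)=\sum_{k=0}^{\lfloor n/2\rfloor}(-1)^k\binom{n+1}{2k+1}x^{n-2k}$. The generating function identity is understood as an identity of formal power series in $z$. *)

theory Defs
  imports Complex_Main "HOL-Computational_Algebra.Computational_Algebra"
begin

definition beta_poly :: "nat \<Rightarrow> real poly" where
  "beta_poly n =
     (\<Sum>k\<le>n div 2. monom ((-1) ^ k * real ((n + 1) choose (2 * k + 1))) (n - 2 * k))"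

lemma poly_beta_poly:
  "poly (beta_poly n) x = Im ((complex_of_real x + \<i>) ^ (n + 1))"
proof -
  define f where "f = (\<lambda>j. Im (of_nat ((n + 1) choose j) * \<i> ^ j * complex_of_real x ^ (n + 1 - j)))"
  have f_even: "f (2 * k) = 0" for k
  proof -
    have "of_nat ((n + 1) choose (2 * k)) * \<i> ^ (2 * k) * complex_of_real x ^ (n + 1 - 2 * k)
        = complex_of_real (real ((n + 1) choose (2 * k)) * (-1) ^ k * x ^ (n + 1 - 2 * k))"
      by (simp add: power_mult)
    then show ?thesis
      unfolding f_def by (metis Im_complex_of_real)
  qed
  have f_odd: "f (2 * k + 1) = (-1) ^ k * real ((n + 1) choose (2 * k + 1)) * x ^ (n - 2 * k)" for k
  proof -
    have "of_nat ((n + 1) choose (2 * k + 1)) * \<i> ^ (2 * k + 1) * complex_of_real x ^ (n + 1 - (2 * k + 1))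
        = \<i> * complex_of_real ((-1) ^ k * real ((n + 1) choose (2 * k + 1)) * x ^ (n - 2 * k))"
      by (simp add: power_mult del: binomial_Suc_Suc)
    then show ?thesis
      unfolding f_def by (metis Im_i_times Re_complex_of_real)
  qed
  have "Im ((complex_of_real x + \<i>) ^ (n + 1)) = Im ((\<i> + complex_of_real x) ^ (n + 1))"
    by (simp add: add.commute)
  also have "\<dots> = (\<Sum>j\<le>n + 1. f j)"
    unfolding f_def binomial_ring Im_sum ..
  also have "\<dots> = (\<Sum>j\<in>(\<lambda>k. 2 * k + 1) ` {..n div 2}. f j)"
  proof (rule sum.mono_neutral_right)
    show "\<forall>j\<in>{..n + 1} - (\<lambda>k. 2 * k + 1) ` {..n div 2}. f j = 0"
    proof
      fix j assume j: "j \<in> {..n + 1} - (\<lambda>k. 2 * k + 1) ` {..n div 2}"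
      show "f j = 0"
      proof (cases "even j")
        case True
        then show ?thesis using f_even by (auto elim: evenE)
      next
        case False
        then obtain k where k: "j = 2 * k + 1" by (auto elim: oddE)
        with j have "k \<le> n div 2" by auto
        with j k show ?thesis by blast
      qed
    qed
  qed auto
  also have "\<dots> = (\<Sum>k\<le>n div 2. f (2 * k + 1))"
    by (subst sum.reindex) (auto simp: inj_on_def)
  also have "\<dots> = poly (beta_poly n) x"
    unfolding f_odd beta_poly_def by (simp add: poly_sum poly_monom)
  finally show ?thesis ..
qed

lemma beta_poly_unique:
  "p = beta_poly n \<longleftrightarrow> (\<forall>x::real. poly p x = Im ((complex_of_real x + \<i>) ^ (n + 1)))"
  by (metis poly_beta_poly poly_eq_poly_eq_iff ext)

text \<open>
  The coefficients of the generating function are embedded into the fraction field of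
  \<open>real poly\<close>, because division of formal power series requires an inverse
  operation on the coefficients, which \<open>real poly\<close> does not have. The variable \<open>x\<close>
  thus remains an indeterminate.
\<close>

definition indet_x :: "real poly fract" where
  "indet_x = to_fract [:0, 1:]"

end

theory Submission
  imports Defs
begin

text \<open>The numbers \<open>x + \<i>\<close> and \<open>x - \<i>\<close> are the roots of
  \<open>w\<^sup>2 - 2 x w + (1 + x\<^sup>2)\<close>, so the powers of \<open>x + \<i>\<close>, and hence their imaginary parts
  \<open>\<beta>\<^sub>n(x)\<close>, satisfy the linear recurrence with this characteristic polynomial. The denominator of
  the generating function is its reversal.\<close>

lemma beta_poly_0 [simp]: "beta_poly 0 = 1"
  by (simp add: beta_poly_def)

lemma beta_poly_Suc_0: "beta_poly (Suc 0) = 2 * [:0, 1:]"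
  by (simp add: beta_poly_def monom_altdef numeral_poly)

lemma beta_poly_Suc_Suc:
  "beta_poly (Suc (Suc n)) = 2 * [:0, 1:] * beta_poly (Suc n) - (1 + [:0, 1:]\<^sup>2) * beta_poly n"
proof -
  \<comment> \<open>A real polynomial is determined by its values, so it suffices to argue at each
    real \<open>x\<close>.\<close>
  have "poly (beta_poly (Suc (Suc n))) x
      = poly (2 * [:0, 1:] * beta_poly (Suc n) - (1 + [:0, 1:]\<^sup>2) * beta_poly n) x" for x
  proof -
    define w where "w = complex_of_real x + \<i>"
    have "w\<^sup>2 = complex_of_real (2 * x) * w - complex_of_real (1 + x\<^sup>2)"
      by (simp add: w_def power2_eq_square algebra_simps)
    moreover have "w ^ (Suc (Suc n) + 1) = w\<^sup>2 * w ^ (n + 1)"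
      by (simp add: power2_eq_square)
    ultimately have "w ^ (Suc (Suc n) + 1) =
        complex_of_real (2 * x) * w ^ (Suc n + 1) - complex_of_real (1 + x\<^sup>2) * w ^ (n + 1)"
      by (simp only:) (simp add: algebra_simps)
    \<comment> \<open>Both coefficients of the recurrence are real, so it passes to imaginary
      parts.\<close>
    moreover have "Im (complex_of_real a * u - complex_of_real b * v) = a * Im u - b * Im v" for a b u v
      by simp
    ultimately have "Im (w ^ (Suc (Suc n) + 1)) = 2 * x * Im (w ^ (Suc n + 1)) - (1 + x\<^sup>2) * Im (w ^ (n + 1))"
      by (simp only:)
    then show ?thesis
      by (simp only: poly_beta_poly w_def poly_diff poly_mult poly_add poly_power) simp
  qed
  then show ?thesis
    by (simp add: poly_eq_poly_eq_iff [symmetric] fun_eq_iff)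
qed

theorem theorem2:
  shows "Abs_fps (\<lambda>n. to_fract (beta_poly n)) =
    1 / (1 - 2 * fps_const indet_x * fps_X + fps_const (1 + indet_x\<^sup>2) * fps_X\<^sup>2)"
  (is "?A = 1 / ?D")
proof -
  have D: "?D = 1 - fps_const (2 * indet_x) * fps_X + fps_const (1 + indet_x\<^sup>2) * fps_X\<^sup>2"
    by (simp add: numeral_fps_const)
  have "to_fract (2 :: real poly) = 2"
    by (metis one_add_one to_fract_1 to_fract_add)
  then have rec: "to_fract (beta_poly (Suc (Suc n))) =
      2 * indet_x * to_fract (beta_poly (Suc n)) - (1 + indet_x\<^sup>2) * to_fract (beta_poly n)"
    and one: "to_fract (beta_poly (Suc 0)) = 2 * indet_x" for n
    by (simp_all only: beta_poly_Suc_Suc beta_poly_Suc_0 indet_x_def power2_eq_square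
        to_fract_add to_fract_diff to_fract_mult to_fract_1)
  have "?D * ?A = 1"
  proof (rule fps_ext)
    fix n
    have "(?D * ?A) $ n = (?A - fps_const (2 * indet_x) * (fps_X * ?A)
        + fps_const (1 + indet_x\<^sup>2) * (fps_X\<^sup>2 * ?A)) $ n"
      unfolding D by (simp add: algebra_simps)
    also have "\<dots> = 1 $ n"
    \<comment> \<open>Powers of \<open>fps_X\<close> shift coefficients: index 0 leaves
      \<open>beta_poly 0\<close>, index 1 cancels by \<open>one\<close>, and all higher indices
      cancel by \<open>rec\<close>.\<close>
    proof (cases n rule: nat.exhaust [case_names zero suc])
      case (suc m)
      then show ?thesis
        by (cases m) (simp_all add: one rec fps_X_power_mult_nth)
    qed simp
    finally show "(?D * ?A) $ n = 1 $ n" .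
  qed
  then have "inverse ?D = ?A"
    by (rule fps_inverse_unique)
  \<comment> \<open>The constant term is 1, so dividing by \<open>?D\<close> is multiplying by
    \<open>inverse ?D\<close>.\<close>
  moreover have "?D $ 0 \<noteq> 0"
    by simp
  ultimately show ?thesis
    by (simp add: fps_divide_unit)
qed

end
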